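(* Let $(e_i)$ be a normalized spreading basis for a Banach space $X$. Then the closed subspace $Y$ of $X$ spanned by the unconditional block basis $(e_{2n-1}-e_{2n})_{n=1}^\infty$ is complemented in $X$. (That is, $(e_{2n-1}-e_{2n})_n$ is an unconditional basic sequence and there is a bounded linear projection of $X$ onto its closed linear span.)
   Context: A basic sequence is spreading if it is equivalent to each of its subsequences. *)

theory Defs
  imports "HOL-Analysis.Analysis"
begin

definition closed_span :: "'a::real_normed_vector set \<Rightarrow> 'a set" where
  "closed_span S = closure (span S)"

text \<open>Sequences are indexed from 0.\<close>

definition schauder_basis_of :: "(nat \<Rightarrow> 'a::real_normed_vector) \<Rightarrow> 'a set \<Rightarrow> bool" where
  "schauder_basis_of e V \<longleftrightarrow>
     closed V \<and> subspace V \<and> range e \<subseteq> V \<and>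
     (\<forall>x\<in>V. \<exists>!a::nat \<Rightarrow> real. (\<lambda>n. a n *\<^sub>R e n) sums x)"

definition basic_sequence :: "(nat \<Rightarrow> 'a::real_normed_vector) \<Rightarrow> bool" where
  "basic_sequence e \<longleftrightarrow> schauder_basis_of e (closed_span (range e))"

definition normalized :: "(nat \<Rightarrow> 'a::real_normed_vector) \<Rightarrow> bool" where
  "normalized e \<longleftrightarrow> (\<forall>n. norm (e n) = 1)"

definition equivalent_sequences ::
    "(nat \<Rightarrow> 'a::real_normed_vector) \<Rightarrow> (nat \<Rightarrow> 'b::real_normed_vector) \<Rightarrow> bool" where
  "equivalent_sequences x y \<longleftrightarrow>
     (\<forall>a::nat \<Rightarrow> real. summable (\<lambda>n. a n *\<^sub>R x n) \<longleftrightarrow> summable (\<lambda>n. a n *\<^sub>R y n))"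

definition spreading :: "(nat \<Rightarrow> 'a::real_normed_vector) \<Rightarrow> bool" where
  "spreading e \<longleftrightarrow>
     basic_sequence e \<and>
     (\<forall>s::nat \<Rightarrow> nat. strict_mono s \<longrightarrow> equivalent_sequences e (e \<circ> s))"

definition unconditionally_convergent :: "(nat \<Rightarrow> 'a::real_normed_vector) \<Rightarrow> bool" where
  "unconditionally_convergent x \<longleftrightarrow>
     (\<forall>p::nat \<Rightarrow> nat. bij p \<longrightarrow> summable (\<lambda>n. x (p n)))"

text \<open>A series \<open>\<Sum>n. a n *\<^sub>R e n\<close> converges iff it is the basis expansion of its sum, an element of
  the closed span.\<close>

definition unconditional_basic_sequence :: "(nat \<Rightarrow> 'a::real_normed_vector) \<Rightarrow> bool" where
  "unconditional_basic_sequence e \<longleftrightarrow>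
     basic_sequence e \<and>
     (\<forall>a::nat \<Rightarrow> real. summable (\<lambda>n. a n *\<^sub>R e n) \<longrightarrow>
        unconditionally_convergent (\<lambda>n. a n *\<^sub>R e n))"

definition complemented :: "'a::real_normed_vector set \<Rightarrow> bool" where
  "complemented Y \<longleftrightarrow>
     (\<exists>P::'a \<Rightarrow> 'a. bounded_linear P \<and> P \<circ> P = P \<and> range P = Y)"

end

theory Submission
  imports Defs
begin

text \<open>Put \<open>d\<^sub>n = e\<^sub>2\<^sub>n - e\<^sub>2\<^sub>n\<^sub>+\<^sub>1\<close>. By spreading, convergence of \<open>\<Sum> b\<^sub>n d\<^sub>n\<close> does not depend on where
  the pairs are placed, as long as their order is kept. Subtracting two placements that share the
  first member of every pair, and the second one precisely for \<open>n \<notin> A\<close>, shows that the subseries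
  over \<open>A\<close> converges as well, for every \<open>A\<close>; this is unconditionality.
  If \<open>\<Sum> a\<^sub>n e\<^sub>n\<close> converges, then so do \<open>\<Sum> a\<^sub>n e\<^sub>2\<^sub>n\<close> and \<open>\<Sum> a\<^sub>n e\<^sub>2\<^sub>n\<^sub>+\<^sub>1\<close>, hence \<open>\<Sum> a\<^sub>n d\<^sub>n\<close>, its
  subseries over the even indices, and finally \<open>\<Sum> a\<^sub>2\<^sub>n d\<^sub>n\<close>. The projection is
  \<open>\<Sum> a\<^sub>n e\<^sub>n \<mapsto> \<Sum> a\<^sub>2\<^sub>n d\<^sub>n\<close>, which is bounded by the closed graph theorem. No uniform spreading
  constant is needed.\<close>

section \<open>Baire category: Zabreiko's lemma and the closed graph theorem\<close>

text \<open>By Baire, the closure of some sublevel set of the seminorm contains a ball. Symmetry and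
  convexity move that ball to the origin, and successive approximation, controlled by countable
  subadditivity, removes the closure.\<close>

lemma zabreiko:
  fixes p :: "'a::banach \<Rightarrow> real"
  assumes add: "\<And>x y. p (x + y) \<le> p x + p y"
    and scale: "\<And>r x. p (r *\<^sub>R x) = \<bar>r\<bar> * p x"
    and countably_subadditive:
      "\<And>x. summable x \<Longrightarrow> summable (\<lambda>k. p (x k)) \<Longrightarrow> p (suminf x) \<le> (\<Sum>k. p (x k))"
  obtains K where "\<And>x. p x \<le> K * norm x"
proof -
  have p0: "p 0 = 0" using scale[of 0 0] by simp
  have pminus: "p (- x) = p x" for x using scale[of "-1" x] by simp
  have pnn: "p x \<ge> 0" for x using add[of x "-x"] p0 pminus[of x] by simp
  define A where "A n = {x. p x \<le> real n}" for n :: nat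
  have cover: "(\<Union>n. closure (A n)) = UNIV"
  proof -
    have "x \<in> (\<Union>n. closure (A n))" for x
    proof -
      obtain n :: nat where "p x \<le> real n" using real_arch_simple by blast
      then have "x \<in> A n" by (simp add: A_def)
      then show ?thesis using closure_subset by blast
    qed
    then show ?thesis by blast
  qed
  obtain n where n: "interior (closure (A n)) \<noteq> {}"
  proof (rule ccontr)
    assume "\<not> thesis"
    then have "interior (closure (A n)) = {}" for n using that by blast
    then have "euclidean interior_of \<Union> (range (\<lambda>n. closure (A n))) = {}"
      by (intro Baire_category_alt) (auto simp: completely_metrizable_space_euclidean)
    then show False using cover by simp
  qed
  then obtain a r where r: "r > 0" and ar: "ball a r \<subseteq> closure (A n)"
    by (metis all_not_in_conv mem_interior)
  \<comment> \<open>The centre \<open>a\<close> cancels in z = ((a + z) - (a - z)) / 2, so half the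
    difference of approximants to \<open>a + z\<close> and \<open>a - z\<close> approximates
    \<open>z\<close>.\<close>
  have approx: "\<exists>w. p w \<le> real n \<and> norm (z - w) < d" if z: "norm z < r" and d: "d > 0" for z d
  proof -
    have "a + z \<in> closure (A n)" "a - z \<in> closure (A n)"
      using ar z by (auto simp: subset_iff dist_norm)
    then obtain u v where u: "u \<in> A n" "dist u (a + z) < d" and v: "v \<in> A n" "dist v (a - z) < d"
      using d by (meson closure_approachable)
    have "p ((1/2) *\<^sub>R (u + - v)) \<le> real n"
      using u v add[of u "-v"] by (simp only: scale) (simp add: A_def pminus)
    moreover have "norm (z - (1/2) *\<^sub>R (u + - v)) < d"
    proof -
      have "z - (1/2) *\<^sub>R (u + - v) = (1/2) *\<^sub>R ((v - (a - z)) - (u - (a + z)))"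
        by (simp add: algebra_simps flip: scaleR_add_left)
      moreover have "norm ((v - (a - z)) - (u - (a + z))) < d + d"
        using u(2) v(2) by (intro norm_triangle_lt[of _ "-_", simplified] le_less_trans[OF norm_triangle_ineq4])
          (auto simp: dist_norm)
      ultimately show ?thesis by simp
    qed
    ultimately show ?thesis by blast
  qed
  have approx_scaled: "\<exists>w. p w \<le> real n / 2 ^ k \<and> norm (z - w) < r / 2 ^ Suc k"
    if "norm z < r / 2 ^ k" for z k
  proof -
    have "norm (2 ^ k *\<^sub>R z) < r" using that by (simp add: field_simps)
    then obtain w where w: "p w \<le> real n" "norm (2 ^ k *\<^sub>R z - w) < r / 2"
      using approx[of "2 ^ k *\<^sub>R z" "r/2"] r by auto
    have "z - (1 / 2 ^ k) *\<^sub>R w = (1 / 2 ^ k) *\<^sub>R (2 ^ k *\<^sub>R z - w)"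
      by (simp add: algebra_simps)
    then have "norm (z - (1 / 2 ^ k) *\<^sub>R w) = norm (2 ^ k *\<^sub>R z - w) / 2 ^ k"
      by simp
    also have "\<dots> < r / 2 ^ Suc k" using w(2) by (simp add: field_simps)
    finally show ?thesis using w(1)
      by (intro exI[of _ "(1 / 2 ^ k) *\<^sub>R w"]) (simp only: scale, simp add: field_simps)
  qed
  have bound: "p x \<le> 2 * real n" if x: "norm x < r" for x
  proof -
    \<comment> \<open>\<open>z k\<close> is the remainder after \<open>k\<close> corrections. The
      corrections telescope to \<open>x\<close>, and their seminorms are dominated by a geometric
      series with sum 2n.\<close>
    obtain z where z: "\<And>k. norm (z k) < r / 2 ^ k" "z 0 = x"
        "\<And>k. p (z k - z (Suc k)) \<le> real n / 2 ^ k"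
    proof -
      have "\<exists>z. \<forall>k. (norm (z k) < r / 2 ^ k \<and> (k = 0 \<longrightarrow> z k = x)) \<and>
              p (z k - z (Suc k)) \<le> real n / 2 ^ k"
      proof (rule dependent_nat_choice)
        fix y k assume "norm y < r / 2 ^ k \<and> (k = 0 \<longrightarrow> y = x)"
        then obtain w where "p w \<le> real n / 2 ^ k" "norm (y - w) < r / 2 ^ Suc k"
          using approx_scaled by blast
        then show "\<exists>y'. (norm y' < r / 2 ^ Suc k \<and> (Suc k = 0 \<longrightarrow> y' = x)) \<and> p (y - y') \<le> real n / 2 ^ k"
          by (intro exI[of _ "y - w"]) simp
      qed (use x in auto)
      then show ?thesis using that by blast
    qed
    have "(\<lambda>k. r * (1/2) ^ k) \<longlonglongrightarrow> 0"
      by (intro tendsto_mult_right_zero LIMSEQ_power_zero) simp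
    then have "z \<longlonglongrightarrow> 0"
      by (rule Lim_null_comparison[rotated]) (use z(1) in \<open>auto intro!: less_imp_le always_eventually simp: power_one_over\<close>)
    then have sums: "(\<lambda>k. z k - z (Suc k)) sums x"
      using telescope_sums'[of z 0] z(2) by simp
    have geo: "(\<lambda>k. real n / 2 ^ k) sums (2 * real n)"
      using sums_mult[OF geometric_sums[of "1/2::real"], of "real n"]
      by (simp add: power_one_over mult.commute)
    have sp: "summable (\<lambda>k. p (z k - z (Suc k)))"
      by (rule summable_comparison_test'[OF sums_summable[OF geo]]) (use z(3) pnn in auto)
    have "p x \<le> (\<Sum>k. p (z k - z (Suc k)))"
      using countably_subadditive[OF sums_summable[OF sums] sp] sums_unique[OF sums] by simp
    also have "\<dots> \<le> 2 * real n"
      using suminf_le[OF z(3) sp sums_summable[OF geo]] sums_unique[OF geo] by simp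
    finally show ?thesis .
  qed
  have "p x \<le> (4 * real n / r) * norm x" for x
  proof (cases "x = 0")
    case False
    \<comment> \<open>The factor 2 puts \<open>c *\<^sub>R x\<close> strictly inside the ball of
      radius \<open>r\<close>; it also turns the bound 2n into 4n / r.\<close>
    define c where "c = r / (2 * norm x)"
    have c: "c > 0" using False r by (simp add: c_def)
    have "norm (c *\<^sub>R x) < r" using False r by (simp add: c_def)
    then have "c * p x \<le> 2 * real n" using bound[of "c *\<^sub>R x"] c by (simp add: scale)
    then show ?thesis using False r by (simp add: c_def field_simps)
  qed (simp add: p0)
  then show thesis using that by blast
qed

text \<open>Zabreiko's lemma applies to the seminorm \<open>norm (T x)\<close>: closedness of the
  graph gives T (\<Sum> x_k) = \<Sum> T x_k whenever both series converge, hence countable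
  subadditivity.\<close>

corollary closed_graph:
  fixes T :: "'a::banach \<Rightarrow> 'b::banach"
  assumes "linear T"
    and closed: "\<And>x l m. x \<longlonglongrightarrow> l \<Longrightarrow> (\<lambda>n. T (x n)) \<longlonglongrightarrow> m \<Longrightarrow> T l = m"
  shows "bounded_linear T"
proof -
  interpret linear T by fact
  obtain K where K: "\<And>x. norm (T x) \<le> K * norm x"
  proof (rule zabreiko[of "\<lambda>x. norm (T x)"])
    fix x :: "nat \<Rightarrow> 'a" assume x: "summable x" "summable (\<lambda>k. norm (T (x k)))"
    have "(\<lambda>n. T (\<Sum>k<n. x k)) \<longlonglongrightarrow> (\<Sum>k. T (x k))"
      using summable_LIMSEQ[OF summable_norm_cancel[OF x(2)]] by (simp add: sum)
    then have "T (suminf x) = (\<Sum>k. T (x k))"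
      using closed summable_LIMSEQ[OF x(1)] by blast
    then show "norm (T (suminf x)) \<le> (\<Sum>k. norm (T (x k)))"
      using summable_norm[OF x(2)] by simp
  qed (auto simp: add scale norm_triangle_ineq)
  show ?thesis by (rule bounded_linear_intro[of _ K]) (simp_all add: add scale K mult.commute)
qed

section \<open>Unconditional convergence from convergence of all subseries\<close>

text \<open>If sums over finite sets far out were not uniformly small, one could pick successive
  finite blocks with large sums, and the subseries over their union would not be Cauchy. Smallness
  over arbitrary finite sets is invariant under permutation.\<close>

lemma unconditionally_convergent_if_subseries:
  fixes x :: "nat \<Rightarrow> 'a::banach"
  assumes sub: "\<And>A. summable (\<lambda>n. if n \<in> A then x n else 0)"
  shows "unconditionally_convergent x"
proof -
  have small: "\<exists>N. \<forall>F. finite F \<and> F \<subseteq> {N..} \<longrightarrow> norm (sum x F) < \<epsilon>" if "\<epsilon> > 0" for \<epsilon>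
  proof (rule ccontr)
    assume "\<not> ?thesis"
    then have ex: "\<exists>F. finite F \<and> F \<subseteq> {N..} \<and> norm (sum x F) \<ge> \<epsilon>" for N
      by (meson not_less)
    have "\<exists>F. \<forall>k. (finite (F k) \<and> F k \<noteq> {} \<and> norm (sum x (F k)) \<ge> \<epsilon>) \<and> Max (F k) < Min (F (Suc k))"
    proof (rule dependent_nat_choice)
      show "\<exists>F. finite F \<and> F \<noteq> {} \<and> \<epsilon> \<le> norm (sum x F)"
        using ex[of 0] \<open>\<epsilon> > 0\<close> by force
    next
      fix F :: "nat set" assume "finite F \<and> F \<noteq> {} \<and> \<epsilon> \<le> norm (sum x F)"
      obtain G where G: "finite G" "G \<subseteq> {Suc (Max F)..}" "norm (sum x G) \<ge> \<epsilon>" using ex by blast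
      then have "G \<noteq> {}" using \<open>\<epsilon> > 0\<close> by auto
      then have "Max F < Min G" using G by (auto simp: Suc_le_eq)
      then show "\<exists>G. (finite G \<and> G \<noteq> {} \<and> \<epsilon> \<le> norm (sum x G)) \<and> Max F < Min G"
        using G \<open>G \<noteq> {}\<close> by blast
    qed
    then obtain F where F: "\<And>k. finite (F k)" "\<And>k. F k \<noteq> {}" "\<And>k. norm (sum x (F k)) \<ge> \<epsilon>"
      "\<And>k. Max (F k) < Min (F (Suc k))" by blast
    have minmax: "Min (F k) \<le> Max (F k)" for k using F by simp
    have mono: "strict_mono (\<lambda>k. Min (F k))"
      using F(4) minmax by (intro strict_mono_Suc_iff[THEN iffD2]) (meson le_less_trans)
    have sep: "Max (F j) < Min (F k)" if "j < k" for j k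
      using F(4)[of j] strict_mono_leD[OF mono, of "Suc j" k] that by simp
    define A where "A = (\<Union>k. F k)"
    \<comment> \<open>Since the blocks follow one another, a stretch of the subseries over
      \<open>A\<close> isolates a single block sum.\<close>
    have block: "A \<inter> {Min (F k)..<Suc (Max (F k))} = F k" for k
    proof -
      have "n \<in> F k" if "n \<in> F j" "Min (F k) \<le> n" "n \<le> Max (F k)" for n j
      proof -
        have "Min (F j) \<le> n" "n \<le> Max (F j)" using F(1) that by auto
        then have "\<not> j < k" "\<not> k < j" using sep that by fastforce+
        then show ?thesis using that by (metis linorder_neqE_nat)
      qed
      moreover have "Min (F k) \<le> n" "n \<le> Max (F k)" if "n \<in> F k" for n
        using F(1) that by auto
      ultimately show ?thesis
        unfolding A_def by (intro set_eqI) (auto simp only: atLeastLessThan_iff less_Suc_eq_le UN_iff Int_iff)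
    qed
    obtain N where N: "\<And>m n. m \<ge> N \<Longrightarrow> norm (sum (\<lambda>n. if n \<in> A then x n else 0) {m..<n}) < \<epsilon>"
      using sub[of A] \<open>\<epsilon> > 0\<close> unfolding summable_Cauchy by blast
    have "sum (\<lambda>n. if n \<in> A then x n else 0) {Min (F N)..<Suc (Max (F N))} = sum x (F N)"
      by (subst sum.inter_restrict[symmetric]) (simp_all only: finite_atLeastLessThan Int_commute[of _ A] block)
    \<comment> \<open>Strict monotonicity gives \<open>N \<le> Min (F N)\<close>, so block number
      \<open>N\<close> already lies beyond the Cauchy threshold.\<close>
    then have "norm (sum x (F N)) < \<epsilon>"
      using N[OF strict_mono_imp_increasing[OF mono, of N], of "Suc (Max (F N))"] by (simp only:)
    then show False using F(3)[of N] by simp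
  qed
  show ?thesis unfolding unconditionally_convergent_def summable_Cauchy
  proof (intro allI impI)
    fix p :: "nat \<Rightarrow> nat" and \<epsilon> :: real assume p: "bij p" and "\<epsilon> > 0"
    obtain N where N: "\<And>F. finite F \<Longrightarrow> F \<subseteq> {N..} \<Longrightarrow> norm (sum x F) < \<epsilon>"
      using small[OF \<open>\<epsilon> > 0\<close>] by auto
    \<comment> \<open>Only finitely many positions are sent below \<open>N\<close>; past the last of
      them, every stretch of the rearranged series is a sum over a finite set beyond
      \<open>N\<close>.\<close>
    have "finite (p -` {..<N})"
      by (rule finite_vimageI[OF finite_lessThan bij_is_inj[OF p]])
    then obtain M where M: "p -` {..<N} \<subseteq> {..<M}"
      using finite_nat_bounded by blast
    have "norm (\<Sum>k=m..<n. x (p k)) < \<epsilon>" if m: "m \<ge> M" for m n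
    proof -
      have "(\<Sum>k=m..<n. x (p k)) = sum x (p ` {m..<n})"
        by (rule sum.reindex[symmetric, unfolded o_def]) (rule inj_on_subset[OF bij_is_inj[OF p] subset_UNIV])
      moreover have "p k \<ge> N" if "k \<ge> m" for k
      proof (rule ccontr)
        assume "\<not> p k \<ge> N"
        then have "k < M" using M by (auto simp: not_le)
        then show False using m that by simp
      qed
      then have "p ` {m..<n} \<subseteq> {N..}" by auto
      ultimately show ?thesis using N by simp
    qed
    then show "\<exists>N. \<forall>m\<ge>N. \<forall>n. norm (\<Sum>k=m..<n. x (p k)) < \<epsilon>" by blast
  qed
qed

section \<open>Closed spans and Schauder bases: coefficients and the basis constant\<close>

lemma subspace_closed_span: "subspace (closed_span S)"
  unfolding subspace_def closed_span_def
proof (intro conjI ballI allI)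
  show "0 \<in> closure (span S)"
    using closure_subset span_zero by blast
next
  fix x y assume "x \<in> closure (span S)" "y \<in> closure (span S)"
  then obtain f g where "\<And>n. f n \<in> span S" "f \<longlonglongrightarrow> x" "\<And>n. g n \<in> span S" "g \<longlonglongrightarrow> y"
    unfolding closure_sequential by blast
  then show "x + y \<in> closure (span S)"
    unfolding closure_sequential
    by (intro exI[of _ "\<lambda>n. f n + g n"]) (simp add: span_add tendsto_add)
next
  fix c :: real and x assume "x \<in> closure (span S)"
  then obtain f where "\<And>n. f n \<in> span S" "f \<longlonglongrightarrow> x"
    unfolding closure_sequential by blast
  then show "c *\<^sub>R x \<in> closure (span S)"
    unfolding closure_sequential
    by (intro exI[of _ "\<lambda>n. c *\<^sub>R f n"]) (simp add: span_scale tendsto_scaleR)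
qed

locale banach_space_basis =
  fixes e :: "nat \<Rightarrow> 'a::banach"
  assumes basis: "schauder_basis_of e UNIV"
begin

definition coeff :: "'a \<Rightarrow> nat \<Rightarrow> real" where
  "coeff x = (THE a. (\<lambda>n. a n *\<^sub>R e n) sums x)"

lemma expansion: "(\<lambda>n. coeff x n *\<^sub>R e n) sums x"
proof -
  have "\<exists>!a. (\<lambda>n. a n *\<^sub>R e n) sums x" using basis by (simp add: schauder_basis_of_def)
  then show ?thesis unfolding coeff_def by (rule theI')
qed

lemma coeff_eqI: "(\<lambda>n. a n *\<^sub>R e n) sums x \<Longrightarrow> coeff x = a"
  using basis expansion[of x] unfolding schauder_basis_of_def by blast

lemma coeff_inject: "coeff x = coeff y \<Longrightarrow> x = y"
  using expansion[of x] expansion[of y] sums_unique2 by metis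

lemma coeff_add: "coeff (x + y) = (\<lambda>n. coeff x n + coeff y n)"
  by (rule coeff_eqI) (simp add: scaleR_add_left sums_add expansion)

lemma coeff_scaleR: "coeff (r *\<^sub>R x) = (\<lambda>n. r * coeff x n)"
  using sums_scaleR_right[OF expansion[of x], of r] by (intro coeff_eqI) simp

lemma coeff_diff: "coeff (x - y) = (\<lambda>n. coeff x n - coeff y n)"
  by (rule coeff_eqI) (simp add: scaleR_diff_left sums_diff expansion)

lemma coeff_basis: "coeff (e k) = (\<lambda>n. if n = k then 1 else 0)"
proof (rule coeff_eqI)
  have "(\<lambda>n. if n = k then e n else 0) sums e k" by (rule sums_single)
  then show "(\<lambda>n. (if n = k then 1 else 0) *\<^sub>R e n) sums e k"
    by (rule back_subst[of "\<lambda>f. f sums _"]) auto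
qed

lemma basis_nonzero: "e k \<noteq> 0"
proof
  assume "e k = 0"
  then have "coeff (e k) = (\<lambda>n. 0)" by (intro coeff_eqI) simp
  then show False by (metis coeff_basis zero_neq_one)
qed

definition partial :: "nat \<Rightarrow> 'a \<Rightarrow> 'a" where
  "partial m x = (\<Sum>i<m. coeff x i *\<^sub>R e i)"

lemma partial_tendsto: "(\<lambda>m. partial m x) \<longlonglongrightarrow> x"
  using expansion[of x] by (simp add: sums_def partial_def)

lemma partial_add: "partial m (x + y) = partial m x + partial m y"
  by (simp add: partial_def coeff_add scaleR_add_left sum.distrib)

lemma partial_scaleR: "partial m (r *\<^sub>R x) = r *\<^sub>R partial m x"
  by (simp add: partial_def coeff_scaleR scaleR_sum_right)

text \<open>The hypothesis of Zabreiko's lemma for the seminorm \<open>sup\<^sub>m \<parallel>partial m x\<parallel>\<close>: the coefficients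
  of \<open>\<Sum>k. x k\<close> are the sums of the coefficients of the \<open>x k\<close>, because the limits in \<open>m\<close> and in the
  number of summands may be exchanged.\<close>

lemma partial_suminf_bound:
  assumes x: "summable x"
    and le: "\<And>m k. norm (partial m (x k)) \<le> p k" and p: "summable p"
  shows "norm (partial m (suminf x)) \<le> suminf p"
proof -
  have norm_term: "norm (coeff (x k) n *\<^sub>R e n) \<le> 2 * p k" for k n
  proof -
    have "coeff (x k) n *\<^sub>R e n = partial (Suc n) (x k) - partial n (x k)"
      by (simp add: partial_def)
    also have "norm \<dots> \<le> p k + p k"
      by (rule order_trans[OF norm_triangle_ineq4 add_mono[OF le le]])
    finally show ?thesis by simp
  qed
  have summable_coeff: "summable (\<lambda>k. coeff (x k) n)" for n
  proof (rule summable_comparison_test')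
    show "summable (\<lambda>k. 2 * p k / norm (e n))" by (intro summable_divide summable_mult p)
    show "norm (coeff (x k) n) \<le> 2 * p k / norm (e n)" for k
      using norm_term[of k n] basis_nonzero[of n] by (simp add: field_simps)
  qed
  define b where "b n = (\<Sum>k. coeff (x k) n)" for n
  have summable_partial: "summable (\<lambda>k. partial m (x k))" for m
    by (rule summable_comparison_test'[OF p]) (rule le)
  have sum_b: "(\<Sum>n<m. b n *\<^sub>R e n) = (\<Sum>k. partial m (x k))" for m
    unfolding partial_def b_def
    by (subst suminf_sum) (auto intro!: sum.cong summable_scaleR_left summable_coeff simp: suminf_scaleR_left[OF summable_coeff])
  \<comment> \<open>The bound \<open>p k\<close> does not depend on \<open>m\<close>, so the
    Weierstrass M-test makes the convergence uniform in \<open>m\<close>, which justifies exchanging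
    the limits.\<close>
  have "(\<lambda>m. \<Sum>k. partial m (x k)) \<longlonglongrightarrow> suminf x"
  proof (rule swap_uniform_limit')
    show "\<forall>\<^sub>F n in sequentially. ((\<lambda>m. \<Sum>k<n. partial m (x k)) \<longlonglongrightarrow> (\<Sum>k<n. x k))"
      by (intro always_eventually allI tendsto_sum partial_tendsto)
    show "(\<lambda>n. \<Sum>k<n. x k) \<longlonglongrightarrow> suminf x" by (rule summable_LIMSEQ[OF x])
    show "uniform_limit UNIV (\<lambda>n m. \<Sum>k<n. partial m (x k)) (\<lambda>m. \<Sum>k. partial m (x k)) sequentially"
      by (rule Weierstrass_m_test[OF le p])
  qed auto
  then have "(\<lambda>n. b n *\<^sub>R e n) sums suminf x" by (simp add: sums_def sum_b)
  then have "partial m (suminf x) = (\<Sum>k. partial m (x k))"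
    by (simp only: partial_def[of m "suminf x"] coeff_eqI sum_b)
  moreover have "norm (\<Sum>k. partial m (x k)) \<le> suminf p"
    by (rule norm_suminf_le[OF le p])
  ultimately show ?thesis by simp
qed

text \<open>Zabreiko's lemma for the supremum \<open>p\<close>, which is finite because the partial
  sums converge. Continuity of the coefficients is not presupposed; it is deduced from this
  bound.\<close>

lemma basis_constant: obtains K where "\<And>m x. norm (partial m x) \<le> K * norm x"
proof -
  define p where "p x = (SUP m. norm (partial m x))" for x
  have bdd: "bdd_above (range (\<lambda>m. norm (partial m x)))" for x
    using convergent_imp_Bseq[OF convergentI[OF partial_tendsto[of x]]]
    by (auto simp: Bseq_def bdd_above_def)
  have le_p: "norm (partial m x) \<le> p x" for m x
    unfolding p_def by (rule cSUP_upper[OF UNIV_I bdd])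
  have p_le: "p x \<le> c" if "\<And>m. norm (partial m x) \<le> c" for x c
    unfolding p_def by (rule cSUP_least) (use that in auto)
  have p_scale_le: "p (r *\<^sub>R x) \<le> \<bar>r\<bar> * p x" for r x
    by (rule p_le) (simp add: partial_scaleR mult_left_mono le_p)
  obtain K where K: "\<And>x. p x \<le> K * norm x"
  proof (rule zabreiko[of p])
    show "p (x + y) \<le> p x + p y" for x y
      by (rule p_le) (simp add: partial_add norm_triangle_le add_mono le_p)
    show "p (r *\<^sub>R x) = \<bar>r\<bar> * p x" for r x
    proof (rule antisym[OF p_scale_le])
      show "\<bar>r\<bar> * p x \<le> p (r *\<^sub>R x)"
      proof (cases "r = 0")
        case True
        then show ?thesis using order_trans[OF norm_ge_zero le_p] by simp
      next
        case False
        then show ?thesis using p_scale_le[of "inverse r" "r *\<^sub>R x"] by (simp add: field_simps)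
      qed
    qed
    show "p (suminf x) \<le> (\<Sum>k. p (x k))" if "summable x" "summable (\<lambda>k. p (x k))" for x
      by (rule p_le) (rule partial_suminf_bound[OF that(1) le_p that(2)])
  qed blast
  show thesis by (rule that) (rule order_trans[OF le_p K])
qed

lemma coeff_bound: obtains K where "\<And>x n. \<bar>coeff x n\<bar> * norm (e n) \<le> K * norm x"
proof -
  obtain K where K: "\<And>m x. norm (partial m x) \<le> K * norm x" using basis_constant by blast
  have "\<bar>coeff x n\<bar> * norm (e n) \<le> (2 * K) * norm x" for x n
  proof -
    have "coeff x n *\<^sub>R e n = partial (Suc n) x - partial n x" by (simp add: partial_def)
    also have "norm \<dots> \<le> K * norm x + K * norm x"
      by (rule order_trans[OF norm_triangle_ineq4 add_mono[OF K K]])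
    finally show ?thesis by simp
  qed
  then show thesis by (rule that)
qed

lemma bounded_linear_coeff: "bounded_linear (\<lambda>x. coeff x n)"
proof -
  obtain K where K: "\<And>x n. \<bar>coeff x n\<bar> * norm (e n) \<le> K * norm x" using coeff_bound by blast
  show ?thesis
    by (rule bounded_linear_intro[of _ "K / norm (e n)"])
      (use K[of _ n] basis_nonzero[of n] in \<open>simp_all add: coeff_add coeff_scaleR field_simps\<close>)
qed

end

section \<open>Splitting a series of pairs\<close>

text \<open>The coefficient sequence b_0, -b_0, b_1, -b_1, ... that arises when a series of
  differences with coefficients \<open>b\<close> is written out term by term.\<close>

definition interleave :: "(nat \<Rightarrow> real) \<Rightarrow> nat \<Rightarrow> real" where
  "interleave b m = (if even m then b (m div 2) else - b (m div 2))"

lemma interleave_simps [simp]: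
  "interleave b (2 * n) = b n" "interleave b (Suc (2 * n)) = - b n"
  by (simp_all add: interleave_def)

lemma sums_pairs:
  assumes "f sums x"
  shows "(\<lambda>n. f (2 * n) + f (2 * n + 1)) sums x"
  using sums_group[OF assms, of 2] by (simp add: mult.commute numeral_2_eq_2)

text \<open>Partial sums of even length are those of the paired series; one of odd length has a
  single extra term \<open>f (2 * n)\<close>, which tends to 0.\<close>

lemma sums_if_sums_pairs:
  fixes f :: "nat \<Rightarrow> 'a::real_normed_vector"
  assumes "(\<lambda>n. f (2 * n) + f (2 * n + 1)) sums x" and "(\<lambda>n. f (2 * n)) \<longlonglongrightarrow> 0"
  shows "f sums x"
proof -
  have even: "(\<Sum>i<2 * n. f i) = (\<Sum>i<n. f (2 * i) + f (2 * i + 1))" for n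
    by (induction n) (simp_all add: algebra_simps)
  have lim: "(\<lambda>n. \<Sum>i<2 * n. f i) \<longlonglongrightarrow> x"
    using assms(1) by (simp only: even sums_def)
  have half: "filterlim (\<lambda>n::nat. n div 2) at_top sequentially"
    by (rule filterlim_at_top_div_const_nat) simp
  have "(\<lambda>n. if even n then 0 else f (2 * (n div 2))) \<longlonglongrightarrow> 0"
    by (rule Lim_null_comparison[OF _ tendsto_norm_zero[OF filterlim_compose[OF assms(2) half]]]) simp
  from tendsto_add[OF filterlim_compose[OF lim half] this]
  have "(\<lambda>n. (\<Sum>i<2 * (n div 2). f i) + (if even n then 0 else f (2 * (n div 2)))) \<longlonglongrightarrow> x"
    by simp
  moreover have "(\<Sum>i<2 * (n div 2). f i) + (if even n then 0 else f (2 * (n div 2))) = (\<Sum>i<n. f i)" for n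
    by (cases "even n") (auto elim!: oddE)
  ultimately show ?thesis unfolding sums_def by simp
qed

section \<open>Spreading bases: differences over pairs and their subseries\<close>

locale spreading_basis = banach_space_basis +
  assumes norm_basis: "norm (e n) = 1"
    and spreading: "strict_mono s \<Longrightarrow>
      summable (\<lambda>n. a n *\<^sub>R e (s n)) \<longleftrightarrow> summable (\<lambda>n. a n *\<^sub>R e n)"
begin

text \<open>The pairs may be split because \<open>b\<close> tends to 0: each \<open>b n\<close> is a
  coefficient of the n-th term, and coefficients are bounded by the norm uniformly in the index, the
  basis being normalized.\<close>

lemma sums_interleave:
  assumes s: "strict_mono s"
    and sums: "(\<lambda>n. b n *\<^sub>R (e (s (2 * n)) - e (s (2 * n + 1)))) sums x"
  shows "(\<lambda>m. interleave b m *\<^sub>R e (s m)) sums x"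
proof (rule sums_if_sums_pairs)
  show "(\<lambda>n. interleave b (2 * n) *\<^sub>R e (s (2 * n)) +
      interleave b (2 * n + 1) *\<^sub>R e (s (2 * n + 1))) sums x"
    using sums by (simp add: scaleR_diff_right)
  obtain K where K: "\<And>x n. \<bar>coeff x n\<bar> * norm (e n) \<le> K * norm x" using coeff_bound by blast
  have "norm (b n) \<le> K * norm (b n *\<^sub>R (e (s (2 * n)) - e (s (2 * n + 1))))" for n
  proof -
    have "s (2 * n) \<noteq> s (2 * n + 1)" using s by (simp add: strict_mono_eq)
    then have "coeff (b n *\<^sub>R (e (s (2 * n)) - e (s (2 * n + 1)))) (s (2 * n)) = b n"
      by (simp add: coeff_scaleR coeff_diff coeff_basis)
    then show ?thesis
      using K[of "b n *\<^sub>R (e (s (2 * n)) - e (s (2 * n + 1)))" "s (2 * n)"] by (simp add: norm_basis)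
  qed
  moreover have "(\<lambda>n. K * norm (b n *\<^sub>R (e (s (2 * n)) - e (s (2 * n + 1))))) \<longlonglongrightarrow> 0"
    by (intro tendsto_mult_right_zero tendsto_norm_zero summable_LIMSEQ_zero sums_summable[OF sums])
  ultimately have "b \<longlonglongrightarrow> 0"
    by (intro Lim_null_comparison[of b]) (auto intro: always_eventually)
  then have "(\<lambda>n. norm (interleave b (2 * n) *\<^sub>R e (s (2 * n)))) \<longlonglongrightarrow> 0"
    using tendsto_rabs_zero by (simp only: norm_scaleR norm_basis interleave_simps mult_1_right)
  then show "(\<lambda>n. interleave b (2 * n) *\<^sub>R e (s (2 * n))) \<longlonglongrightarrow> 0"
    by (rule tendsto_norm_zero_cancel)
qed

text \<open>Once the pairs are split, the series runs along a subsequence of the basis, so spreading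
  applies: first from \<open>s\<close> back to the basis, then on to \<open>t\<close>. Regrouping
  recovers the pairs.\<close>

lemma summable_respread:
  assumes s: "strict_mono s" and t: "strict_mono t"
    and "summable (\<lambda>n. b n *\<^sub>R (e (s (2 * n)) - e (s (2 * n + 1))))"
  shows "summable (\<lambda>n. b n *\<^sub>R (e (t (2 * n)) - e (t (2 * n + 1))))"
proof -
  have "summable (\<lambda>m. interleave b m *\<^sub>R e (s m))"
    using sums_interleave[OF s] assms(3) unfolding summable_def by blast
  then have "summable (\<lambda>m. interleave b m *\<^sub>R e (t m))"
    using spreading[OF s] spreading[OF t] by simp
  from sums_summable[OF sums_pairs[OF summable_sums[OF this]]]
  show ?thesis by (simp add: scaleR_diff_right)
qed

definition diffs :: "nat \<Rightarrow> 'a" where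
  "diffs n = e (2 * n) - e (2 * n + 1)"

lemma coeff_sums_diffs:
  assumes "(\<lambda>n. b n *\<^sub>R diffs n) sums x"
  shows "coeff x = interleave b"
  using sums_interleave[OF strict_mono_id, of b x] assms
  by (intro coeff_eqI) (simp add: diffs_def)

lemma summable_diffs_if_respread:
  assumes "strict_mono s" "summable (\<lambda>n. b n *\<^sub>R (e (s (2 * n)) - e (s (2 * n + 1))))"
  shows "summable (\<lambda>n. b n *\<^sub>R diffs n)"
  using summable_respread[OF assms(1) strict_mono_id assms(2)] by (simp add: diffs_def)

lemma summable_respread_diffs:
  assumes "strict_mono s" "summable (\<lambda>n. b n *\<^sub>R diffs n)"
  shows "summable (\<lambda>n. b n *\<^sub>R (e (s (2 * n)) - e (s (2 * n + 1))))"
  using summable_respread[OF strict_mono_id assms(1), of b] assms(2) by (simp add: diffs_def)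

lemma summable_diffs_subseries:
  assumes b: "summable (\<lambda>n. b n *\<^sub>R diffs n)"
  shows "summable (\<lambda>n. if n \<in> A then b n *\<^sub>R diffs n else 0)"
proof -
  \<comment> \<open>Subtracting the spread copy with pairs \<open>(3n, 3n+1)\<close> for \<open>n \<in> A\<close> and \<open>(3n, 3n+2)\<close> for \<open>n \<notin> A\<close>
    from the one with pairs \<open>(3n, 3n+2)\<close> throughout leaves only the terms with \<open>n \<in> A\<close>.\<close>
  define s where "s B m = 3 * (m div 2) + (if even m then 0 else if m div 2 \<in> B then 1 else 2)"
    for B and m :: nat
  have s: "strict_mono (s B)" for B
  proof (unfold strict_mono_Suc_iff, intro allI)
    show "s B m < s B (Suc m)" for m
      by (cases "even m") (simp_all add: s_def)
  qed
  \<comment> \<open>For n in \<open>A\<close> the common member \<open>e (3 * n)\<close> cancels,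
    which leaves the pair (3n+1, 3n+2). \<open>u\<close> enumerates these pairs for all n, and
    \<open>b'\<close> kills those outside \<open>A\<close>.\<close>
  define u :: "nat \<Rightarrow> nat" where "u m = 3 * (m div 2) + (if even m then 1 else 2)" for m
  have u: "strict_mono u"
  proof (unfold strict_mono_Suc_iff, intro allI)
    show "u m < u (Suc m)" for m
      by (cases "even m") (simp_all add: u_def)
  qed
  define b' where "b' n = (if n \<in> A then b n else 0)" for n
  have "summable (\<lambda>n. b n *\<^sub>R (e (s {} (2 * n)) - e (s {} (2 * n + 1))) -
      b n *\<^sub>R (e (s A (2 * n)) - e (s A (2 * n + 1))))"
    by (intro summable_diff summable_respread_diffs s b)
  also have "(\<lambda>n. b n *\<^sub>R (e (s {} (2 * n)) - e (s {} (2 * n + 1))) -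
      b n *\<^sub>R (e (s A (2 * n)) - e (s A (2 * n + 1)))) =
    (\<lambda>n. b' n *\<^sub>R (e (u (2 * n)) - e (u (2 * n + 1))))"
    by (auto simp: s_def u_def b'_def fun_eq_iff algebra_simps)
  finally have "summable (\<lambda>n. b' n *\<^sub>R diffs n)"
    by (rule summable_diffs_if_respread[OF u])
  then show ?thesis
    by (rule back_subst[of summable]) (auto simp: b'_def)
qed

section \<open>The closed span of the differences and its basis\<close>

lemma closed_span_diffs_memI:
  assumes "(\<lambda>n. b n *\<^sub>R diffs n) sums x"
  shows "x \<in> closed_span (range diffs)"
proof -
  have "(\<Sum>i<n. b i *\<^sub>R diffs i) \<in> closure (span (range diffs))" for n
    by (rule subsetD[OF closure_subset]) (intro span_sum span_scale span_base rangeI)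
  then show ?thesis
    using assms unfolding closed_span_def sums_def
    by (intro Lim_in_closed_set[OF closed_closure _ _ assms[unfolded sums_def]]) auto
qed

text \<open>Opposite coefficients within each pair are a closed linear condition satisfied by every
  difference, hence by the whole closed span. Grouping the basis expansion in pairs then gives the
  series.\<close>

lemma closed_span_diffs_expansion:
  assumes "x \<in> closed_span (range diffs)"
  shows "(\<lambda>n. coeff x (2 * n) *\<^sub>R diffs n) sums x"
proof -
  define Z where "Z = {x. \<forall>n. coeff x (2 * n + 1) = - coeff x (2 * n)}"
  have "subspace Z"
    using coeff_scaleR[of 0 0] unfolding subspace_def Z_def
    by (auto simp: coeff_add coeff_scaleR)
  moreover have "range diffs \<subseteq> Z"
    by (auto simp: Z_def diffs_def coeff_diff coeff_basis) presburger+
  ultimately have "span (range diffs) \<subseteq> Z" by (simp add: span_minimal)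
  moreover have "closed Z"
    unfolding Z_def
    by (intro closed_Collect_all closed_Collect_eq continuous_on_minus
      linear_continuous_on bounded_linear_coeff)
  ultimately have "x \<in> Z"
    using assms closure_minimal unfolding closed_span_def by blast
  then show ?thesis
    using sums_pairs[OF expansion[of x]] by (simp add: Z_def diffs_def scaleR_diff_right)
qed

lemma basic_sequence_diffs: "basic_sequence diffs"
  unfolding basic_sequence_def schauder_basis_of_def
proof (intro conjI ballI)
  show "closed (closed_span (range diffs))" by (simp add: closed_span_def)
  show "subspace (closed_span (range diffs))" by (rule subspace_closed_span)
  show "range diffs \<subseteq> closed_span (range diffs)"
    unfolding closed_span_def by (rule order_trans[OF span_superset closure_subset])
  fix x assume "x \<in> closed_span (range diffs)"
  then have ex: "(\<lambda>n. coeff x (2 * n) *\<^sub>R diffs n) sums x" by (rule closed_span_diffs_expansion)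
  show "\<exists>!a. (\<lambda>n. a n *\<^sub>R diffs n) sums x"
  proof (rule ex1I)
    show "(\<lambda>n. coeff x (2 * n) *\<^sub>R diffs n) sums x" by (rule ex)
    fix a assume "(\<lambda>n. a n *\<^sub>R diffs n) sums x"
    then show "a = (\<lambda>n. coeff x (2 * n))" by (simp add: coeff_sums_diffs)
  qed
qed

lemma unconditional_diffs: "unconditional_basic_sequence diffs"
  unfolding unconditional_basic_sequence_def
proof (intro conjI allI impI basic_sequence_diffs)
  fix b :: "nat \<Rightarrow> real" assume "summable (\<lambda>n. b n *\<^sub>R diffs n)"
  then show "unconditionally_convergent (\<lambda>n. b n *\<^sub>R diffs n)"
    by (intro unconditionally_convergent_if_subseries summable_diffs_subseries)
qed

section \<open>The projection onto the closed span\<close>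

definition proj :: "'a \<Rightarrow> 'a" where
  "proj x = (\<Sum>n. coeff x (2 * n) *\<^sub>R diffs n)"

lemma summable_proj: "summable (\<lambda>n. coeff x (2 * n) *\<^sub>R diffs n)"
proof -
  have x: "summable (\<lambda>n. coeff x n *\<^sub>R e n)" by (rule sums_summable[OF expansion])
  have "strict_mono (\<lambda>n::nat. 2 * n)" "strict_mono (\<lambda>n::nat. 2 * n + 1)"
    by (simp_all add: strict_mono_def)
  then have "summable (\<lambda>n. coeff x n *\<^sub>R e (2 * n) - coeff x n *\<^sub>R e (2 * n + 1))"
    using x by (intro summable_diff) (simp_all only: spreading)
  then have "summable (\<lambda>n. coeff x n *\<^sub>R diffs n)"
    by (simp add: diffs_def scaleR_diff_right)
  then have "summable (\<lambda>n. if n \<in> range ((*) 2) then coeff x n *\<^sub>R diffs n else 0)"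
    by (rule summable_diffs_subseries)
  then have even: "summable (\<lambda>n. coeff x (2 * n) *\<^sub>R diffs (2 * n))"
    by (subst (asm) summable_mono_reindex[of "(*) 2", symmetric]) (auto simp: strict_mono_def)
  \<comment> \<open>\<open>diffs (2 * n)\<close> is the pair (4n, 4n+1), so the subseries over even
    indices is a series along \<open>s\<close>; moving its pairs to (2n, 2n+1) yields the
    claim.\<close>
  define s :: "nat \<Rightarrow> nat" where "s m = 4 * (m div 2) + m mod 2" for m
  have "strict_mono s"
  proof (unfold strict_mono_Suc_iff, intro allI)
    show "s m < s (Suc m)" for m
      unfolding s_def by presburger
  qed
  then show ?thesis
    by (rule summable_diffs_if_respread) (use even in \<open>simp add: s_def diffs_def\<close>)
qed

lemma proj_sums: "(\<lambda>n. coeff x (2 * n) *\<^sub>R diffs n) sums proj x"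
  unfolding proj_def by (rule summable_sums[OF summable_proj])

lemma coeff_proj: "coeff (proj x) = interleave (\<lambda>n. coeff x (2 * n))"
  by (rule coeff_sums_diffs[OF proj_sums])

text \<open>Each coefficient of \<open>proj x\<close> is, up to sign, a coefficient of
  \<open>x\<close>. Linearity can thus be read off coefficientwise, and continuity of the
  coefficients closes the graph.\<close>

lemma bounded_linear_proj: "bounded_linear proj"
proof (rule closed_graph)
  show "linear proj"
  proof
    show "proj (x + y) = proj x + proj y" for x y
      by (rule coeff_inject) (simp add: coeff_proj coeff_add interleave_def fun_eq_iff)
    show "proj (r *\<^sub>R x) = r *\<^sub>R proj x" for r x
      by (rule coeff_inject) (simp add: coeff_proj coeff_scaleR interleave_def fun_eq_iff)
  qed
  fix x l m assume x: "x \<longlonglongrightarrow> l" and px: "(\<lambda>n. proj (x n)) \<longlonglongrightarrow> m"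
  have "coeff (proj l) i = coeff m i" for i
  proof (rule LIMSEQ_unique)
    note lim = bounded_linear.tendsto[OF bounded_linear_coeff]
    show "(\<lambda>n. coeff (proj (x n)) i) \<longlonglongrightarrow> coeff m i" by (rule lim[OF px])
    show "(\<lambda>n. coeff (proj (x n)) i) \<longlonglongrightarrow> coeff (proj l) i"
      by (cases "even i") (simp_all add: coeff_proj interleave_def lim[OF x] tendsto_minus)
  qed
  then show "proj l = m" by (intro coeff_inject) blast
qed

text \<open>On the closed span, the series defining \<open>proj x\<close> is the expansion of
  \<open>x\<close> itself, so \<open>proj\<close> fixes its range.\<close>

lemma complemented_diffs: "complemented (closed_span (range diffs))"
proof -
  have mem: "proj x \<in> closed_span (range diffs)" for x
    by (rule closed_span_diffs_memI[OF proj_sums])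
  have fixed: "proj x = x" if "x \<in> closed_span (range diffs)" for x
    by (rule sums_unique2[OF proj_sums closed_span_diffs_expansion[OF that]])
  have "proj \<circ> proj = proj" using mem fixed by auto
  moreover have "range proj = closed_span (range diffs)"
    using mem fixed by (metis (no_types, lifting) image_subset_iff rangeI subsetI subset_antisym)
  ultimately show ?thesis
    unfolding complemented_def using bounded_linear_proj by blast
qed

end

theorem proposition2p7:
  fixes e :: "nat \<Rightarrow> 'a::banach"
  assumes "schauder_basis_of e UNIV"
    and "normalized e"
    and "spreading e"
  shows "unconditional_basic_sequence (\<lambda>n. e (2 * n) - e (2 * n + 1)) \<and>
    complemented (closed_span (range (\<lambda>n. e (2 * n) - e (2 * n + 1))))"
proof -
  interpret spreading_basis e
  proof
    show "schauder_basis_of e UNIV" by fact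
    show "norm (e n) = 1" for n
      using assms(2) by (simp add: normalized_def)
    show "summable (\<lambda>n. a n *\<^sub>R e (s n)) \<longleftrightarrow> summable (\<lambda>n. a n *\<^sub>R e n)"
      if "strict_mono s" for s a
      using assms(3) that by (simp add: spreading_def equivalent_sequences_def)
  qed
  show ?thesis
    using unconditional_diffs complemented_diffs by (simp add: diffs_def[abs_def])
qed

end
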